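(* Let $\Gamma$ be a distance-regular graph of diameter $d\ge 1$ with intersection array $\{b_0,b_1,\ldots,b_{d-1};c_1,c_2,\ldots,c_d\}$, let $k=b_0$ be its valency, and let $a_1=k-b_1-c_1$. Then $\Gamma$ yields a binary even LCD code if and only if (i) $b_0\equiv 0\pmod 2$; (ii) $a_1\equiv 1\pmod 2$; and (iii) $c_2\equiv 0\pmod 2$.
   Context: A connected finite simple graph $\Gamma$ of diameter $d$ is distance-regular if there are integers $b_i$ ($0\le i\le d-1$) and $c_i$ ($1\le i\le d$) such that for any two vertices $x,y$ at distance $i$, the number of neighbours of $y$ at distance $i-1$ from $x$ is $c_i$ and the number of neighbours of $y$ at distance $i+1$ from $x$ is $b_i$. The sequence $\{b_0,\ldots,b_{d-1};c_1,\ldots,c_d\}$ is the intersection array. Conventions when $d=1$: $b_1=0$ and $c_2=0$. A binary code of length $n$ is a linear subspace $C\subseteq\mathbb{F}_2^n$ (the zero code is allowed). Its dual $C^\perp$ is taken with respect to $\langle x,y\rangle=\sum_i x_iy_i$. $C$ is LCD (linear complementary dual) if $C\cap C^\perp=\{0\}$, equivalently $\mathbb{F}_2^n=C\oplus C^\perp$. $C$ is even if every codeword has even Hamming weight. For an LCD code $C$, the orthogonal projector $\Pi_C$ is the unique $n\times n$ matrix over $\mathbb{F}_2$ with $v\Pi_C=v$ for all row vectors $v\in C$ and $v\Pi_C=0$ for all $v\in C^\perp$. A finite simple graph on $n$ (ordered) vertices with adjacency matrix $A$ is said to yield a binary even LCD code if $A$, read over $\mathbb{F}_2$, equals $\Pi_C$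 for some binary even LCD code $C$ of length $n$; this $C$ (which is the row span of $A$ over $\mathbb{F}_2$) is the code yielded by the graph. *)

theory Defs
  imports
    "HOL-Analysis.Analysis"
    "HOL-Library.Z2"
    "HOL-Number_Theory.Cong"
    "Graph_Theory.Graph_Theory"
begin

section \<open>Distance-regular graphs\<close>

text \<open>
  A finite simple graph is a \<^locale>\<open>pair_graph\<close>: finitely many vertices, and the set of arcs
  is a symmetric irreflexive relation on them, so an edge is a pair of opposite arcs.
\<close>

text \<open>The value is meaningful only when \<open>y\<close> is reachable from \<open>x\<close>.\<close>

definition graph_dist :: "'a pair_pre_digraph \<Rightarrow> 'a \<Rightarrow> 'a \<Rightarrow> nat" where
  "graph_dist G x y = (LEAST l. \<exists>p. pre_digraph.awalk (with_proj G) x p y \<and> length p = l)"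

definition graph_diameter :: "'a pair_pre_digraph \<Rightarrow> nat" where
  "graph_diameter G = Max {graph_dist G x y | x y. x \<in> pverts G \<and> y \<in> pverts G}"

text \<open>
  Connectedness is qualified because the topological notion has the same name; it includes that
  the vertex set is nonempty. Of the families \<open>b\<close> and \<open>c\<close>, only
  \<open>b 0, ..., b (d - 1)\<close> and \<open>c 1, ..., c d\<close> are constrained, where \<open>d\<close> is the diameter.
\<close>

definition distance_regular ::
    "'a pair_pre_digraph \<Rightarrow> nat \<Rightarrow> (nat \<Rightarrow> int) \<Rightarrow> (nat \<Rightarrow> int) \<Rightarrow> bool" where
  "distance_regular G d b c \<longleftrightarrow>
     pair_graph G \<and> Digraph_Component.connected (with_proj G) \<and> graph_diameter G = d \<and>
     (\<forall>x \<in> pverts G. \<forall>y \<in> pverts G. \<forall>i. graph_dist G x y = i \<longrightarrow>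
        (1 \<le> i \<and> i \<le> d \<longrightarrow>
           int (card {z. (y, z) \<in> parcs G \<and> graph_dist G x z = i - 1}) = c i) \<and>
        (i < d \<longrightarrow>
           int (card {z. (y, z) \<in> parcs G \<and> graph_dist G x z = i + 1}) = b i))"


section \<open>Binary LCD codes\<close>

text \<open>
  \<^typ>\<open>bit\<close> is the field with two elements; words are row vectors whose coordinates are
  indexed by a finite type \<open>'n\<close>, the length being \<open>CARD('n)\<close>.
\<close>

definition dual_code :: "(bit ^ 'n) set \<Rightarrow> (bit ^ 'n) set" where
  "dual_code C = {y. \<forall>x \<in> C. (\<Sum>i\<in>UNIV. x $ i * y $ i) = 0}"

definition lcd_code :: "(bit ^ 'n) set \<Rightarrow> bool" where
  "lcd_code C \<longleftrightarrow> vec.subspace C \<and> C \<inter> dual_code C = {0}"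

definition hamming_weight :: "bit ^ 'n \<Rightarrow> nat" where
  "hamming_weight x = card {i. x $ i \<noteq> 0}"

definition even_code :: "(bit ^ 'n) set \<Rightarrow> bool" where
  "even_code C \<longleftrightarrow> (\<forall>x \<in> C. even (hamming_weight x))"

text \<open>Existence and uniqueness of this matrix hold when \<open>C\<close> is an LCD code.\<close>

definition orth_projector :: "(bit ^ 'n) set \<Rightarrow> bit ^ 'n ^ 'n" where
  "orth_projector C = (THE P. (\<forall>v \<in> C. v v* P = v) \<and> (\<forall>v \<in> dual_code C. v v* P = 0))"


section \<open>Codes yielded by graphs\<close>

text \<open>The bijection \<open>vert\<close> from the index type onto the vertex set is the ordering of the vertices.\<close>

definition adjacency_matrix :: "'a pair_pre_digraph \<Rightarrow> ('n \<Rightarrow> 'a) \<Rightarrow> bit ^ 'n ^ 'n" where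
  "adjacency_matrix G vert = (\<chi> i j. if (vert i, vert j) \<in> parcs G then 1 else 0)"

definition yields_even_lcd_code :: "'a pair_pre_digraph \<Rightarrow> ('n::finite \<Rightarrow> 'a) \<Rightarrow> bool" where
  "yields_even_lcd_code G vert \<longleftrightarrow>
     (\<exists>C. lcd_code C \<and> even_code C \<and> adjacency_matrix G vert = orth_projector C)"

end

theory Submission
  imports Defs
begin

text \<open>
  A projector is idempotent. Conversely, a symmetric idempotent matrix over the two-element field
  is the orthogonal projector onto its row space, and if its diagonal vanishes then that row space
  is even, because the column sums of \<open>A\<close> are the diagonal entries of \<open>A ** A\<close>. So the graph yields
  an even LCD code iff \<open>A ** A = A\<close>. The entries of \<open>A ** A\<close> count common neighbours modulo 2,
  and in a distance-regular graph these numbers are \<open>b\<^sub>0\<close>, \<open>a\<^sub>1\<close>, \<open>c\<^sub>2\<close> and \<open>0\<close> for pairs of vertices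
  at distance \<open>0\<close>, \<open>1\<close>, \<open>2\<close> and more.
\<close>

section \<open>Orthogonal projectors over the two-element field\<close>

text \<open>Makes codes finite sets, so that an injective self-map of a code is onto.\<close>

instance bit :: finite
proof
  have "UNIV = {0, 1 :: bit}"
    by (auto intro: bit.exhaust)
  then show "finite (UNIV :: bit set)"
    by (metis finite.emptyI finite_insert)
qed

section \<open>The standard bilinear form and dual codes\<close>

definition dot :: "bit ^ 'n \<Rightarrow> bit ^ 'n \<Rightarrow> bit" where
  "dot x y = (\<Sum>i\<in>UNIV. x $ i * y $ i)"

lemma dot_commute: "dot x y = dot y x"
  by (simp only: dot_def mult.commute)

lemma dot_add_left: "dot (x + y) z = dot x z + dot y z"
  by (simp only: dot_def vector_add_component distrib_right sum.distrib)

lemma dot_add_right: "dot z (x + y) = dot z x + dot z y"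
  by (simp only: dot_commute[of z] dot_add_left)

lemma dot_scale_left: "dot (a *s x) z = a * dot x z"
  by (simp only: dot_def vector_smult_component sum_distrib_left mult.assoc)

lemma dot_scale_right: "dot z (a *s x) = a * dot z x"
  by (simp only: dot_commute[of z] dot_scale_left)

lemma dot_diff_left: "dot (x - y) z = dot x z - dot y z"
  by (simp only: dot_def vector_minus_component left_diff_distrib sum_subtractf)

lemma dot_zero [simp]: "dot 0 z = 0" "dot z 0 = 0"
  by (simp_all add: dot_def)

text \<open>This adjunction is how symmetry of a matrix enters: a symmetric \<open>A\<close> moves
  freely across the form.\<close>

lemma dot_vector_matrix: "dot (x v* A) y = dot x (y v* transpose A)"
proof -
  have "dot (x v* A) y = (\<Sum>j\<in>UNIV. \<Sum>i\<in>UNIV. x $ i * A $ i $ j * y $ j)"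
    by (simp only: dot_def vector_matrix_mult_def vec_lambda_beta sum_distrib_right)
  also have "\<dots> = (\<Sum>i\<in>UNIV. \<Sum>j\<in>UNIV. x $ i * A $ i $ j * y $ j)"
    by (rule sum.swap)
  also have "\<dots> = dot x (y v* transpose A)"
    by (simp only: dot_def vector_matrix_mult_def vec_lambda_beta sum_distrib_left transpose_def ac_simps)
  finally show ?thesis .
qed

lemma dot_axis: "dot x (axis i 1) = x $ i"
  by (simp add: dot_def axis_def if_distrib[of "(*) _"] sum.delta del: mult_bit_eq_and cong: if_cong)

lemma dual_code_iff: "y \<in> dual_code C \<longleftrightarrow> (\<forall>x\<in>C. dot x y = 0)"
  by (simp add: dual_code_def dot_def)

lemma subspace_dual_code:
  fixes C :: "(bit ^ 'n::finite) set"
  shows "vec.subspace (dual_code C)"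
  by (simp add: vec.subspace_def dual_code_iff dot_add_right dot_scale_right)

lemma vector_matrix_mult_eq_sum: "v v* P = (\<Sum>i\<in>UNIV. v $ i *s row i P)"
  by (simp add: vec_eq_iff vector_matrix_mult_def row_def del: mult_bit_eq_and)

text \<open>
  For a basis \<open>B\<close> of \<open>C\<close>, the map sending \<open>v\<close> to the combination of \<open>B\<close> with coefficients
  \<open>\<langle>v, b\<rangle>\<close> has kernel the dual code. It is therefore injective on the finite set \<open>C\<close>,
  hence surjective onto it.
\<close>

lemma lcd_code_decomposition:
  fixes C :: "(bit ^ 'n::finite) set"
  assumes "lcd_code C"
  shows "\<exists>v\<in>C. x - v \<in> dual_code C"
proof -
  have C: "vec.subspace C" and int: "C \<inter> dual_code C = {0}"
    using assms by (auto simp: lcd_code_def)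
  obtain B where B: "B \<subseteq> C" "vec.independent B" "C \<subseteq> vec.span B"
    using vec.maximal_independent_subset by blast
  have fin: "finite B" using B(2) vec.finiteI_independent by blast
  define T where "T v = (\<Sum>b\<in>B. dot v b *s b)" for v
  have T_in: "T v \<in> C" for v
    unfolding T_def using B(1) by (intro vec.subspace_sum[OF C] vec.subspace_scale[OF C]) auto
  have T_diff: "T (u - v) = T u - T v" for u v
    by (simp only: T_def dot_diff_left vec.scale_left_diff_distrib sum_subtractf)
  \<comment> \<open>Not restricted to \<open>C\<close>: injectivity uses it for \<open>u - v\<close>
    inside \<open>C\<close>, the final step for \<open>x - v\<close> with \<open>x\<close>
    arbitrary.\<close>
  have kernel: "v \<in> dual_code C" if "T v = 0" for v
  proof -
    have "dot b v = 0" if "b \<in> B" for b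
      using vec.independentD[OF B(2) fin subset_refl \<open>T v = 0\<close>[unfolded T_def] that]
      by (simp only: dot_commute)
    then have "B \<subseteq> {y. dot y v = 0}"
      by blast
    moreover have "vec.subspace {y. dot y v = 0}"
      by (simp add: vec.subspace_def dot_add_left dot_scale_left)
    ultimately have "C \<subseteq> {y. dot y v = 0}"
      using B(3) vec.span_minimal by blast
    then show ?thesis
      unfolding dual_code_iff by blast
  qed
  have "inj_on T C"
  proof (rule inj_onI)
    fix u v assume uv: "u \<in> C" "v \<in> C" "T u = T v"
    then have "u - v \<in> dual_code C"
      by (intro kernel) (simp add: T_diff)
    moreover have "u - v \<in> C"
      using uv vec.subspace_diff[OF C] by blast
    ultimately have "u - v = 0"
      using int by blast
    then show "u = v" by simp
  qed
  then have "T ` C = C"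
    using T_in by (intro endo_inj_surj) auto
  then obtain v where "v \<in> C" "T v = T x"
    using T_in by (metis imageE)
  then show ?thesis
    using kernel[of "x - v"] by (auto simp: T_diff)
qed

text \<open>Every word is a codeword plus a dual word, so the two conditions fix the action on all
  row vectors.\<close>

lemma orth_projector_unique:
  fixes C :: "(bit ^ 'n::finite) set"
  assumes "lcd_code C"
    and P: "\<forall>v\<in>C. v v* P = v" "\<forall>v\<in>dual_code C. v v* P = 0"
  shows "orth_projector C = P"
  unfolding orth_projector_def
proof (rule the_equality)
  show "(\<forall>v\<in>C. v v* P = v) \<and> (\<forall>v\<in>dual_code C. v v* P = 0)"
    using P by blast
  fix Q assume Q: "(\<forall>v\<in>C. v v* Q = v) \<and> (\<forall>v\<in>dual_code C. v v* Q = 0)"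
  have "x v* Q = x v* P" for x
  proof -
    obtain v where "v \<in> C" "x - v \<in> dual_code C"
      using lcd_code_decomposition[OF assms(1)] by blast
    then have "(v + (x - v)) v* Q = (v + (x - v)) v* P"
      using P Q by (simp only: vector_matrix_left_distrib)
    then show ?thesis by simp
  qed
  then show "Q = P"
    by (metis matrix_eq transpose_matrix_vector transpose_transpose)
qed

text \<open>The existence half behind the \<open>THE\<close>: a witness is the matrix whose rows are
  the code parts of the unit vectors.\<close>

lemma orth_projector_works:
  fixes C :: "(bit ^ 'n::finite) set"
  assumes "lcd_code C"
  shows "v \<in> C \<Longrightarrow> v v* orth_projector C = v"
    and "v \<in> dual_code C \<Longrightarrow> v v* orth_projector C = 0"
proof -
  have C: "vec.subspace C" and int: "C \<inter> dual_code C = {0}"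
    using assms by (auto simp: lcd_code_def)
  obtain p where p: "\<And>x. p x \<in> C" "\<And>x. x - p x \<in> dual_code C"
    using lcd_code_decomposition[OF assms] by metis
  \<comment> \<open>The choice function \<open>p\<close> is not known to be linear; only its values
    at unit vectors are used, and \<open>P\<close> extends them linearly.\<close>
  define P :: "bit ^ 'n ^ 'n" where "P = (\<chi> i. p (axis i 1))"
  have row: "row i P = p (axis i 1)" for i
    by (simp add: P_def row_def vec_eq_iff)
  have in_C: "v v* P \<in> C" for v
    unfolding vector_matrix_mult_eq_sum row
    by (intro vec.subspace_sum[OF C] vec.subspace_scale[OF C] p)
  have in_dual: "v - v v* P \<in> dual_code C" for v
  proof -
    have "v - v v* P = (\<Sum>i\<in>UNIV. v $ i *s (axis i 1 - p (axis i 1)))"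
      unfolding vector_matrix_mult_eq_sum row vec.scale_right_diff_distrib sum_subtractf
      by (simp only: basis_expansion)
    also have "\<dots> \<in> dual_code C"
      by (intro vec.subspace_sum[OF subspace_dual_code] vec.subspace_scale[OF subspace_dual_code] p)
    finally show ?thesis .
  qed
  have on_C: "v v* P = v" if "v \<in> C" for v
    using vec.subspace_diff[OF C that in_C[of v]] in_dual[of v] int
    by (metis IntI eq_iff_diff_eq_0 singletonD)
  \<comment> \<open>Here \<open>v v* P\<close> is the difference of the dual words \<open>v\<close>
    and \<open>v - v v* P\<close>, and it also lies in \<open>C\<close>.\<close>
  have on_dual: "v v* P = 0" if "v \<in> dual_code C" for v
    using vec.subspace_diff[OF subspace_dual_code that in_dual[of v]] in_C[of v] int
    by auto
  have "orth_projector C = P"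
    using on_C on_dual by (intro orth_projector_unique assms) auto
  then show "v \<in> C \<Longrightarrow> v v* orth_projector C = v"
    and "v \<in> dual_code C \<Longrightarrow> v v* orth_projector C = 0"
    using on_C on_dual by auto
qed

text \<open>One application replaces a word by its code part, which a second application
  fixes.\<close>

lemma orth_projector_idempotent:
  fixes C :: "(bit ^ 'n::finite) set"
  assumes "lcd_code C"
  shows "orth_projector C ** orth_projector C = orth_projector C" (is "?P ** ?P = ?P")
proof -
  have "x v* (?P ** ?P) = x v* ?P" for x
  proof -
    obtain v where v: "v \<in> C" "x - v \<in> dual_code C"
      using lcd_code_decomposition[OF assms] by blast
    have "x v* ?P = (v + (x - v)) v* ?P" by simp
    also have "\<dots> = v"
      using orth_projector_works[OF assms] v by (simp only: vector_matrix_left_distrib) simp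
    finally show ?thesis
      using orth_projector_works(1)[OF assms v(1)] by (simp flip: vector_matrix_mul_assoc)
  qed
  then show ?thesis
    by (metis matrix_eq transpose_matrix_vector transpose_transpose)
qed

text \<open>Idempotence makes \<open>A\<close> the identity on its row space; symmetry makes
  \<open>A\<close> annihilate the dual of that space. A word in both is fixed and annihilated, hence
  zero.\<close>

lemma symmetric_idempotent_is_orth_projector:
  fixes A :: "bit ^ 'n::finite ^ 'n"
  assumes sym: "transpose A = A" and idem: "A ** A = A"
  shows "lcd_code (range (\<lambda>v. v v* A))" and "orth_projector (range (\<lambda>v. v v* A)) = A"
proof -
  let ?C = "range (\<lambda>v. v v* A)"
  have fixed: "v v* A = v" if "v \<in> ?C" for v
    using that idem by (auto simp: vector_matrix_mul_assoc)
  have dual: "y v* A = 0" if "y \<in> dual_code ?C" for y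
  proof -
    have "(y v* A) $ i = 0" for i
    proof -
      \<comment> \<open>Coordinate \<open>i\<close> of \<open>y v* A\<close> pairs \<open>y\<close>
        with row \<open>i\<close> of \<open>A\<close>, which belongs to the row space.\<close>
      have "(y v* A) $ i = dot (y v* A) (axis i 1)" by (simp only: dot_axis)
      also have "\<dots> = dot y (axis i 1 v* A)"
        by (simp only: dot_vector_matrix[of y] sym)
      also have "\<dots> = dot (axis i 1 v* A) y"
        by (rule dot_commute)
      also have "\<dots> = 0" using that unfolding dual_code_iff by blast
      finally show ?thesis .
    qed
    then show ?thesis by (simp add: vec_eq_iff)
  qed
  have C: "vec.subspace ?C"
    unfolding vec.subspace_def
  proof (intro conjI ballI allI)
    show "0 \<in> ?C" by (metis rangeI vector_matrix_mult_0)
    show "x + y \<in> ?C" if "x \<in> ?C" "y \<in> ?C" for x y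
      using that by (metis fixed rangeI vector_matrix_left_distrib)
    show "a *s x \<in> ?C" if "x \<in> ?C" for a x
      using that by (metis fixed rangeI scalar_vector_matrix_assoc)
  qed
  have "?C \<inter> dual_code ?C \<subseteq> {0}"
  proof
    fix v assume "v \<in> ?C \<inter> dual_code ?C"
    then show "v \<in> {0}"
      using fixed[of v] dual[of v] by simp
  qed
  then show lcd: "lcd_code ?C"
    unfolding lcd_code_def
    using C vec.subspace_0[OF C] vec.subspace_0[OF subspace_dual_code] by blast
  show "orth_projector ?C = A"
    using fixed dual by (intro orth_projector_unique[OF lcd]) blast+
qed

section \<open>Sums of bits as parities, and even row spaces\<close>

lemma of_nat_bit_eq_0_iff: "(of_nat m :: bit) = 0 \<longleftrightarrow> even m"
  by (induction m) auto

lemma sum_indicator_bit: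
  fixes f :: "'n::finite \<Rightarrow> bit"
  shows "sum f UNIV = of_nat (card {i. f i \<noteq> 0})"
proof -
  have "sum f UNIV = (\<Sum>i\<in>UNIV. if f i \<noteq> 0 then 1 else 0)"
    by (rule sum.cong) auto
  also have "\<dots> = of_nat (card {i. f i \<noteq> 0})"
    by (simp flip: sum.inter_filter)
  finally show ?thesis .
qed

text \<open>Here \<open>1\<close> is the all-ones word, so evenness becomes orthogonality to
  it.\<close>

lemma even_hamming_weight_iff:
  fixes x :: "bit ^ 'n::finite"
  shows "even (hamming_weight x) \<longleftrightarrow> dot x 1 = 0"
  unfolding hamming_weight_def
  by (simp add: dot_def sum_indicator_bit of_nat_bit_eq_0_iff del: bit_not_zero_iff)

lemma yields_even_lcd_projector_iff_idempotent:
  fixes A :: "bit ^ 'n::finite ^ 'n"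
  assumes sym: "transpose A = A" and diag: "\<And>i. A $ i $ i = 0"
  shows "(\<exists>C. lcd_code C \<and> even_code C \<and> A = orth_projector C) \<longleftrightarrow> A ** A = A"
proof
  assume "\<exists>C. lcd_code C \<and> even_code C \<and> A = orth_projector C"
  then show "A ** A = A"
    using orth_projector_idempotent by auto
next
  assume idem: "A ** A = A"
  have A_sym: "A $ i $ j = A $ j $ i" for i j
    using sym by (metis transpose_def vec_lambda_beta)
  have "(1 v* A) $ j = 0" for j
  proof -
    have "(1 v* A) $ j = (\<Sum>i\<in>UNIV. A $ i $ j)"
      by (simp only: vector_matrix_mult_def vec_lambda_beta one_index mult_1)
    \<comment> \<open>Every bit equals its own square, and \<open>A\<close> is symmetric.\<close>
    also have "\<dots> = (\<Sum>i\<in>UNIV. A $ j $ i * A $ i $ j)"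
      by (intro sum.cong refl) (metis A_sym bit.exhaust mult_1 mult_zero_left)
    also have "\<dots> = (A ** A) $ j $ j"
      by (simp only: matrix_matrix_mult_def vec_lambda_beta)
    finally show ?thesis
      using idem diag by simp
  qed
  then have "1 v* A = 0"
    by (simp add: vec_eq_iff)
  then have "dot (v v* A) 1 = 0" for v
    by (simp only: dot_vector_matrix sym dot_zero)
  then have "even_code (range (\<lambda>v. v v* A))"
    by (auto simp: even_code_def even_hamming_weight_iff)
  then show "\<exists>C. lcd_code C \<and> even_code C \<and> A = orth_projector C"
    using symmetric_idempotent_is_orth_projector[OF sym idem] by metis
qed

section \<open>Adjacency matrices and common neighbours\<close>

lemma (in pair_sym_digraph) parcs_sym: "(x, y) \<in> parcs G \<longleftrightarrow> (y, x) \<in> parcs G"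
  using arcs_symmetric[of x y] arcs_symmetric[of y x] by auto

lemma (in pair_graph) adjacency_matrix_square:
  fixes vert :: "'n::finite \<Rightarrow> 'a"
  assumes "bij_betw vert UNIV (pverts G)"
  shows "(adjacency_matrix G vert ** adjacency_matrix G vert) $ i $ j =
    of_nat (card {z. (vert i, z) \<in> parcs G \<and> (vert j, z) \<in> parcs G})"
proof -
  let ?K = "{k. (vert i, vert k) \<in> parcs G \<and> (vert j, vert k) \<in> parcs G}"
  let ?A = "adjacency_matrix G vert"
  have "{k. ?A $ i $ k * ?A $ k $ j \<noteq> 0} = ?K"
    using parcs_sym by (auto simp: adjacency_matrix_def)
  then have "(?A ** ?A) $ i $ j = of_nat (card ?K)"
    by (simp only: matrix_matrix_mult_def vec_lambda_beta sum_indicator_bit)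
  moreover have "inj_on vert ?K"
    using assms by (auto simp: bij_betw_def inj_on_def)
  \<comment> \<open>Neighbours are vertices, hence indexed by \<open>vert\<close>, so counting
    indices and counting vertices agree.\<close>
  moreover have "vert ` ?K = {z. (vert i, z) \<in> parcs G \<and> (vert j, z) \<in> parcs G}"
  proof (intro equalityI subsetI)
    fix z assume z: "z \<in> {z. (vert i, z) \<in> parcs G \<and> (vert j, z) \<in> parcs G}"
    then obtain k where "z = vert k"
      using bij_betw_imp_surj_on[OF assms] in_arcsD2[of "vert i" z] by blast
    then show "z \<in> vert ` ?K"
      using z by blast
  qed blast
  ultimately show ?thesis
    by (simp flip: card_image)
qed

text \<open>This is \<open>A ** A = A\<close> read entry by entry; undirected edges make
  \<open>A\<close> symmetric and the absence of loops makes its diagonal zero.\<close>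

lemma (in pair_graph) yields_even_lcd_code_iff:
  fixes vert :: "'n::finite \<Rightarrow> 'a"
  assumes "bij_betw vert UNIV (pverts G)"
  shows "yields_even_lcd_code G vert \<longleftrightarrow>
    (\<forall>x\<in>pverts G. \<forall>y\<in>pverts G.
      odd (card {z. (x, z) \<in> parcs G \<and> (y, z) \<in> parcs G}) \<longleftrightarrow> (x, y) \<in> parcs G)"
proof -
  let ?A = "adjacency_matrix G vert"
  have "transpose ?A = ?A"
    using parcs_sym by (simp add: transpose_def adjacency_matrix_def vec_eq_iff)
  moreover have "?A $ i $ i = 0" for i
    using pair_no_loops[of "(vert i, vert i)"] by (auto simp: adjacency_matrix_def)
  ultimately have "yields_even_lcd_code G vert \<longleftrightarrow> ?A ** ?A = ?A"
    unfolding yields_even_lcd_code_def by (rule yields_even_lcd_projector_iff_idempotent)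
  also have "\<dots> \<longleftrightarrow> (\<forall>i j. odd (card {z. (vert i, z) \<in> parcs G \<and> (vert j, z) \<in> parcs G})
      \<longleftrightarrow> (vert i, vert j) \<in> parcs G)"
    unfolding vec_eq_iff adjacency_matrix_square[OF assms]
    by (simp add: adjacency_matrix_def of_nat_bit_eq_0_iff flip: bit_not_zero_iff) blast
  also have "\<dots> \<longleftrightarrow> (\<forall>x\<in>range vert. \<forall>y\<in>range vert.
      odd (card {z. (x, z) \<in> parcs G \<and> (y, z) \<in> parcs G}) \<longleftrightarrow> (x, y) \<in> parcs G)"
    by blast
  finally show ?thesis
    by (simp only: bij_betw_imp_surj_on[OF assms])
qed

section \<open>Graph distance\<close>

lemma (in pair_wf_digraph) graph_dist_le:
  "awalk x p y \<Longrightarrow> graph_dist G x y \<le> length p"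
  unfolding graph_dist_def by (rule Least_le) blast

text \<open>Reachability gives some walk length, so the \<open>LEAST\<close> is attained.\<close>

lemma (in pair_wf_digraph) graph_dist_awalk:
  assumes "x \<rightarrow>\<^sup>*\<^bsub>with_proj G\<^esub> y"
  obtains p where "awalk x p y" "length p = graph_dist G x y"
proof -
  have "\<exists>l p. awalk x p y \<and> length p = l"
    using assms by (auto simp: reachable_awalk)
  then have "\<exists>p. awalk x p y \<and> length p = graph_dist G x y"
    unfolding graph_dist_def by (rule LeastI_ex)
  then show ?thesis using that by blast
qed

lemma (in pair_wf_digraph) graph_dist_eq_0_iff:
  assumes "x \<rightarrow>\<^sup>*\<^bsub>with_proj G\<^esub> y"
  shows "graph_dist G x y = 0 \<longleftrightarrow> x = y"
proof
  assume "graph_dist G x y = 0"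
  then show "x = y"
    using graph_dist_awalk[OF assms] by (metis awalk_Nil_iff length_0_conv)
next
  assume "x = y"
  then show "graph_dist G x y = 0"
    using graph_dist_le[of x "[]" y] reachable_in_verts(1)[OF assms] by (simp add: awalk_Nil_iff)
qed

lemma (in pair_loopfree_digraph) graph_dist_eq_1_iff:
  assumes "x \<rightarrow>\<^sup>*\<^bsub>with_proj G\<^esub> y"
  shows "graph_dist G x y = 1 \<longleftrightarrow> (x, y) \<in> parcs G"
proof
  assume "graph_dist G x y = 1"
  then obtain e where "awalk x [e] y"
    using graph_dist_awalk[OF assms] by (metis One_nat_def length_0_conv length_Suc_conv)
  then show "(x, y) \<in> parcs G"
    by (cases e) (auto simp: awalk_simps)
next
  assume xy: "(x, y) \<in> parcs G"
  then have "awalk x [(x, y)] y"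
    by (simp add: awalk_simps in_arcsD2)
  then have "graph_dist G x y \<le> 1"
    using graph_dist_le[of x "[(x, y)]" y] by simp
  moreover have "graph_dist G x y \<noteq> 0"
    using pair_no_loops[OF xy] graph_dist_eq_0_iff[OF assms] by simp
  ultimately show "graph_dist G x y = 1" by simp
qed

lemma (in pair_wf_digraph) graph_dist_step:
  assumes "x \<rightarrow>\<^sup>*\<^bsub>with_proj G\<^esub> y" and "(y, z) \<in> parcs G"
  shows "graph_dist G x z \<le> Suc (graph_dist G x y)"
proof -
  obtain p where p: "awalk x p y" "length p = graph_dist G x y"
    using graph_dist_awalk[OF assms(1)] .
  have "awalk y [(y, z)] z"
    using assms(2) by (simp add: awalk_simps in_arcsD1 in_arcsD2)
  then have "awalk x (p @ [(y, z)]) z"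
    by (rule awalk_appendI[OF p(1)])
  then show ?thesis
    using graph_dist_le[of x "p @ [(y, z)]" z] p(2) by simp
qed

text \<open>Cut a shortest walk after \<open>n\<close> arcs. A shorter walk to the cut vertex,
  joined to the remainder, would shorten the whole walk.\<close>

lemma (in pair_wf_digraph) graph_dist_intermediate:
  assumes "x \<rightarrow>\<^sup>*\<^bsub>with_proj G\<^esub> y" and "n \<le> graph_dist G x y"
  obtains z where "x \<rightarrow>\<^sup>*\<^bsub>with_proj G\<^esub> z" "graph_dist G x z = n"
proof -
  obtain p where p: "awalk x p y" "length p = graph_dist G x y"
    using graph_dist_awalk[OF assms(1)] .
  obtain z where pz: "awalk x (take n p) z" "awalk z (drop n p) y"
    using p(1) awalk_append_iff[of x "take n p" "drop n p" y] by auto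
  then have xz: "x \<rightarrow>\<^sup>*\<^bsub>with_proj G\<^esub> z"
    using reachable_awalkI by blast
  have "graph_dist G x z \<le> n"
    using graph_dist_le[OF pz(1)] by simp
  moreover obtain q where "awalk x q z" "length q = graph_dist G x z"
    using graph_dist_awalk[OF xz] .
  then have "graph_dist G x y \<le> graph_dist G x z + (graph_dist G x y - n)"
    using graph_dist_le[OF awalk_appendI[OF _ pz(2)], of x q] p(2) by simp
  ultimately show ?thesis
    using that[OF xz] assms(2) by simp
qed

section \<open>Common neighbours in a distance-regular graph\<close>

theorem theorem4p1:
  fixes G :: "'a pair_pre_digraph"
    and vert :: "'n::finite \<Rightarrow> 'a"
    and d :: nat
    and b c :: "nat \<Rightarrow> int"
    and k a1 :: int
  assumes "distance_regular G d b c"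
    and "d \<ge> 1"
    and "d = 1 \<Longrightarrow> b 1 = 0"
    and "d = 1 \<Longrightarrow> c 2 = 0"
    and "k = b 0"
    and "a1 = k - b 1 - c 1"
    and "bij_betw vert UNIV (pverts G)"
  shows "yields_even_lcd_code G vert \<longleftrightarrow>
    [b 0 = 0] (mod 2) \<and> [a1 = 1] (mod 2) \<and> [c 2 = 0] (mod 2)"
proof -
  interpret pair_graph G
    using assms(1) by (simp add: distance_regular_def)
  let ?D = "graph_dist G"
  define common where "common x y = card {z. (x, z) \<in> parcs G \<and> (y, z) \<in> parcs G}" for x y
  have c: "int (card {z. (y, z) \<in> parcs G \<and> ?D x z = i - 1}) = c i"
    if "x \<in> pverts G" "y \<in> pverts G" "?D x y = i" "1 \<le> i" "i \<le> d" for x y i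
    using assms(1) that unfolding distance_regular_def by blast
  have b: "int (card {z. (y, z) \<in> parcs G \<and> ?D x z = i + 1}) = b i"
    if "x \<in> pverts G" "y \<in> pverts G" "?D x y = i" "i < d" for x y i
    using assms(1) that unfolding distance_regular_def by blast
  \<comment> \<open>Connectedness refers to the symmetric closure; the arcs are already symmetric,
    so reachability is the same in \<open>G\<close>.\<close>
  have reach: "x \<rightarrow>\<^sup>*\<^bsub>with_proj G\<^esub> y" if "x \<in> pverts G" "y \<in> pverts G" for x y
    using assms(1) that reachable_mk_symmetric_eq[OF pair_sym_arcs]
    by (auto simp: distance_regular_def Digraph_Component.connected_def strongly_connected_def)
  let ?S = "{?D x y | x y. x \<in> pverts G \<and> y \<in> pverts G}"
  have fin: "finite ?S"
    using pair_finite_verts by (intro finite_image_set2) auto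
  have d: "d = Max ?S"
    using assms(1) by (simp add: distance_regular_def graph_diameter_def)
  have nonempty: "pverts G \<noteq> {}"
    using assms(1) by (simp add: distance_regular_def Digraph_Component.connected_def strongly_connected_def)
  have le_d: "?D x y \<le> d" if "x \<in> pverts G" "y \<in> pverts G" for x y
    unfolding d using that by (intro Max_ge fin) blast
  have "?S \<noteq> {}"
    using nonempty by blast
  then have "d \<in> ?S"
    unfolding d by (rule Max_in[OF fin])
  then obtain u v where uv: "u \<in> pverts G" "v \<in> pverts G" "?D u v = d"
    by blast
  \<comment> \<open>A shortest walk from \<open>u\<close> to \<open>v\<close> meets every distance
    from 0 to \<open>d\<close>, so the parity conditions can be tested on actual pairs of
    vertices.\<close>
  have attained: "\<exists>z\<in>pverts G. ?D u z = n" if "n \<le> d" for n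
    using graph_dist_intermediate[OF reach[OF uv(1,2)], of n] that uv(3)
    by (metis reachable_in_verts(2) with_proj_simps(1))
  have fin_nbrs: "finite {z. (y, z) \<in> parcs G \<and> P z}" for y P
    using pair_finite_verts by (rule rev_finite_subset) (auto dest: in_arcsD2)
  have common_eq: "common x y = card {z. (y, z) \<in> parcs G \<and> ?D x z = 1}"
    if "x \<in> pverts G" for x y
  proof -
    have "(x, z) \<in> parcs G \<longleftrightarrow> ?D x z = 1" if "(y, z) \<in> parcs G" for z
      using graph_dist_eq_1_iff[OF reach] \<open>x \<in> pverts G\<close> in_arcsD2[OF that] by blast
    then show ?thesis
      unfolding common_def by (metis (no_types, lifting))
  qed
  have common_0: "int (common x x) = b 0" if "x \<in> pverts G" for x
    using b[OF that that, of 0] graph_dist_eq_0_iff[OF reach[OF that that]] assms(2)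
    by (simp add: common_eq that)
  \<comment> \<open>The neighbours of \<open>y\<close> lie at distance 0, 1 or 2 from
    \<open>x\<close>. These classes have sizes \<open>c 1\<close>, \<open>common x y\<close> and
    \<open>b 1\<close>, and together they make up the valency \<open>k\<close>.\<close>
  have common_1: "int (common x y) = a1" if x: "x \<in> pverts G" and y: "y \<in> pverts G"
    and xy: "?D x y = 1" for x y
  proof -
    let ?N = "\<lambda>i. {z. (y, z) \<in> parcs G \<and> ?D x z = i}"
    have "?D x z \<le> 2" if "(y, z) \<in> parcs G" for z
      using graph_dist_step[OF reach[OF x y] that] xy by simp
    then have "{z. (y, z) \<in> parcs G} = ?N 0 \<union> ?N 1 \<union> ?N 2"
      by (fastforce simp: le_Suc_eq numeral_2_eq_2)
    then have "common y y = card (?N 0 \<union> ?N 1 \<union> ?N 2)"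
      by (simp only: common_def conj_absorb)
    also have "\<dots> = card (?N 0 \<union> ?N 1) + card (?N 2)"
      by (intro card_Un_disjoint finite_UnI fin_nbrs) auto
    also have "card (?N 0 \<union> ?N 1) = card (?N 0) + card (?N 1)"
      by (intro card_Un_disjoint fin_nbrs) auto
    finally have "k = int (card (?N 0)) + int (common x y) + int (card (?N 2))"
      using common_0[OF y] assms(5) by (simp add: common_eq[OF x])
    moreover have "int (card (?N 0)) = c 1"
      using c[OF x y xy] assms(2) by simp
    moreover have "int (card (?N 2)) = b 1"
    \<comment> \<open>For \<open>d = 1\<close>, distance-regularity does not constrain
      \<open>b 1\<close>; the convention \<open>b 1 = 0\<close> matches the empty class.\<close>
    proof (cases "d = 1")
      case True
      then have "?N 2 = {}"
        using le_d[OF x] in_arcsD2 by fastforce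
      then show ?thesis
        using assms(3)[OF True] by (simp only: card.empty of_nat_0)
    next
      case False
      then have "1 < d"
        using assms(2) by simp
      then show ?thesis
        using b[OF x y xy] by (simp only: one_add_one)
    qed
    ultimately show ?thesis
      using assms(6) by simp
  qed
  have common_2: "int (common x y) = c 2" if x: "x \<in> pverts G" and y: "y \<in> pverts G"
    and xy: "?D x y = 2" for x y
    using c[OF x y xy] le_d[OF x y] xy by (simp add: common_eq[OF x])
  have common_gt_2: "common x y = 0" if x: "x \<in> pverts G" and y: "y \<in> pverts G"
    and xy: "?D x y > 2" for x y
  proof -
    \<comment> \<open>A common neighbour would join \<open>x\<close> to \<open>y\<close> by a walk
      of length 2.\<close>
    have "?D x z \<noteq> 1" if "(y, z) \<in> parcs G" for z
      using graph_dist_step[OF reach, of x z y] x xy in_arcsD2[OF that] that parcs_sym[of y z] by auto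
    then have "{z. (y, z) \<in> parcs G \<and> ?D x z = 1} = {}"
      by blast
    then show ?thesis
      by (simp only: common_eq[OF x] card.empty)
  qed
  have arc: "(x, y) \<in> parcs G \<longleftrightarrow> ?D x y = 1" if "x \<in> pverts G" "y \<in> pverts G" for x y
    using graph_dist_eq_1_iff[OF reach[OF that]] by simp
  have "yields_even_lcd_code G vert \<longleftrightarrow>
      (\<forall>x\<in>pverts G. \<forall>y\<in>pverts G. odd (int (common x y)) \<longleftrightarrow> ?D x y = 1)"
    using yields_even_lcd_code_iff[OF assms(7)] arc by (simp add: common_def)
  also have "\<dots> \<longleftrightarrow> even (b 0) \<and> odd a1 \<and> even (c 2)"
  proof
    assume odd_iff: "\<forall>x\<in>pverts G. \<forall>y\<in>pverts G. odd (int (common x y)) \<longleftrightarrow> ?D x y = 1"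
    obtain y where "y \<in> pverts G" "?D u y = 1"
      using attained assms(2) by blast
    then have "odd a1"
      using odd_iff uv(1) common_1[of u y] by metis
    moreover have "even (b 0)"
      using odd_iff uv(1) common_0[OF uv(1)] graph_dist_eq_0_iff[OF reach[OF uv(1) uv(1)]]
      by (metis zero_neq_one)
    moreover have "even (c 2)"
    \<comment> \<open>For \<open>d = 1\<close> no pair is at distance 2, and the convention
      \<open>c 2 = 0\<close> supplies the parity.\<close>
    proof (cases "d = 1")
      case True
      then show ?thesis using assms(4) by simp
    next
      case False
      then obtain y where "y \<in> pverts G" "?D u y = 2"
        using attained[of 2] assms(2) by fastforce
      then show ?thesis
        using odd_iff uv(1) common_2[of u y] by (metis numeral_eq_one_iff num.distinct(1))
    qed
    ultimately show "even (b 0) \<and> odd a1 \<and> even (c 2)" by blast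
  next
    assume par: "even (b 0) \<and> odd a1 \<and> even (c 2)"
    show "\<forall>x\<in>pverts G. \<forall>y\<in>pverts G. odd (int (common x y)) \<longleftrightarrow> ?D x y = 1"
    proof (intro ballI)
      fix x y assume x: "x \<in> pverts G" and y: "y \<in> pverts G"
      consider "?D x y = 0" | "?D x y = 1" | "?D x y = 2" | "?D x y > 2"
        by linarith
      then show "odd (int (common x y)) \<longleftrightarrow> ?D x y = 1"
      proof cases
        case 1
        then have "x = y"
          using graph_dist_eq_0_iff[OF reach[OF x y]] by simp
        then show ?thesis using 1 par common_0[OF x] by simp
      next
        case 2
        then show ?thesis using par common_1[OF x y] by simp
      next
        case 3
        then show ?thesis using par common_2[OF x y] by simp
      next
        case 4
        then show ?thesis using common_gt_2[OF x y] by simp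
      qed
    qed
  qed
  also have "\<dots> \<longleftrightarrow> [b 0 = 0] (mod 2) \<and> [a1 = 1] (mod 2) \<and> [c 2 = 0] (mod 2)"
    by (simp add: cong_def even_iff_mod_2_eq_zero odd_iff_mod_2_eq_one)
  finally show ?thesis .
qed

end
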